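(* Let $k$ be an algebraically closed field of characteristic zero, let $B$ be a finitely generated $k$-domain, and let $D$ be a semisimple $k$-derivation of $B$ whose eigenvalues are all integers. Assume that there exists a nonzero element $s\in B$ such that $D(s)=s$. Let $B=k[b_1,\dots,b_n]$ with $D(b_i)=\lambda_i b_i$, $\lambda_i\in\mathbb{Z}$, for $i=1,\dots,n$, and set $B_s:=B[s^{-1}]$. Then $$\ker(D|_{B_s})=k\left[b_1s^{-\lambda_1},\dots,b_ns^{-\lambda_n}\right].$$
   Context: A $k$-derivation $D$ of $B$ is called semisimple if $B$ is the direct sum of the eigenspaces of $D$, i.e. $B=\bigoplus_{\lambda\in k}B_\lambda$ with $B_\lambda=\{b\in B\mid D(b)=\lambda b\}$; its eigenvalues are the $\lambda\in k$ with $B_\lambda\neq 0$. Since $k$ has characteristic zero, $\mathbb{Z}$ is regarded as a subset of $k$. $B=k[b_1,\dots,b_n]$ means that $b_1,\dots,b_n$ generate $B$ as a $k$-algebra (they are not assumed algebraically independent). $D|_{B_s}$ is the unique extension of $D$ to a derivation of the localization $B_s$ (quotient rule), and $k[u_1,\dots,u_n]$ denotes the $k$-subalgebra of $B_s$ generated by $u_1,\dots,u_n$. *)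

theory Defs
  imports "HOL-Computational_Algebra.Computational_Algebra"
begin

section \<open>Commutative algebras over a field\<close>

locale comm_algebra = vector_space scale
  for scale :: "'k::field \<Rightarrow> 'b::comm_ring_1 \<Rightarrow> 'b" +
  assumes scale_mult_left: "scale c x * y = scale c (x * y)"

definition subalgebra :: "('k::field \<Rightarrow> 'b::comm_ring_1 \<Rightarrow> 'b) \<Rightarrow> 'b set \<Rightarrow> bool" where
  "subalgebra scale S \<longleftrightarrow>
     module.subspace scale S \<and> 1 \<in> S \<and> (\<forall>x\<in>S. \<forall>y\<in>S. x * y \<in> S)"

definition generated_subalgebra :: "('k::field \<Rightarrow> 'b::comm_ring_1 \<Rightarrow> 'b) \<Rightarrow> 'b set \<Rightarrow> 'b set" where
  "generated_subalgebra scale U = \<Inter>{S. subalgebra scale S \<and> U \<subseteq> S}"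

definition finitely_generated_algebra :: "('k::field \<Rightarrow> 'b::comm_ring_1 \<Rightarrow> 'b) \<Rightarrow> bool" where
  "finitely_generated_algebra scale \<longleftrightarrow> (\<exists>U. finite U \<and> generated_subalgebra scale U = UNIV)"


section \<open>Derivations and semisimplicity\<close>

definition k_derivation :: "('k::field \<Rightarrow> 'b::comm_ring_1 \<Rightarrow> 'b) \<Rightarrow> ('b \<Rightarrow> 'b) \<Rightarrow> bool" where
  "k_derivation scale D \<longleftrightarrow>
     Vector_Spaces.linear scale scale D \<and> (\<forall>x y. D (x * y) = D x * y + x * D y)"

definition eigenspace :: "('k \<Rightarrow> 'b \<Rightarrow> 'b) \<Rightarrow> ('b \<Rightarrow> 'b) \<Rightarrow> 'k \<Rightarrow> 'b set" where
  "eigenspace scale D c = {b. D b = scale c b}"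

definition eigenvalues :: "('k \<Rightarrow> 'b::zero \<Rightarrow> 'b) \<Rightarrow> ('b \<Rightarrow> 'b) \<Rightarrow> 'k set" where
  "eigenvalues scale D = {c. eigenspace scale D c \<noteq> {0}}"

text \<open>The whole type is the internal direct sum of a (possibly infinite) family of subgroups:
  every element is in exactly one way a finitely supported sum of members of the family.\<close>

definition is_direct_sum :: "('i \<Rightarrow> 'b::ab_group_add set) \<Rightarrow> bool" where
  "is_direct_sum V \<longleftrightarrow>
     (\<forall>x. \<exists>!f. (\<forall>i. f i \<in> V i) \<and> finite {i. f i \<noteq> 0} \<and> x = (\<Sum>i | f i \<noteq> 0. f i))"

definition semisimple :: "('k \<Rightarrow> 'b::ab_group_add \<Rightarrow> 'b) \<Rightarrow> ('b \<Rightarrow> 'b) \<Rightarrow> bool" where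
  "semisimple scale D \<longleftrightarrow> is_direct_sum (eigenspace scale D)"


section \<open>Localization at one element of a domain\<close>

text \<open>Since the ring is a domain, its localization at the powers of \<open>s \<noteq> 0\<close> is realised
  as a subring of the field of fractions. The scalar multiplication and the derivation are defined
  on the whole field of fractions and are to be restricted to \<open>localization s\<close>.\<close>

definition localization :: "'b::idom \<Rightarrow> 'b fract set" where
  "localization s = {Fract a (s ^ m) | a m. True}"

definition fract_scale :: "('k \<Rightarrow> 'b::idom \<Rightarrow> 'b) \<Rightarrow> 'k \<Rightarrow> 'b fract \<Rightarrow> 'b fract" where
  "fract_scale scale c x = to_fract (scale c 1) * x"

text \<open>The extension of a derivation by the quotient rule. The description is well defined when
  \<open>D\<close> is a derivation (lemma \<open>fract_deriv_Fract\<close>); the lemmas after it show that it is then the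
  unique derivation of \<open>localization s\<close> that extends \<open>D\<close>.\<close>

definition fract_deriv :: "('b::idom \<Rightarrow> 'b) \<Rightarrow> 'b fract \<Rightarrow> 'b fract" where
  "fract_deriv D x =
     (THE y. \<forall>a b. b \<noteq> 0 \<longrightarrow> x = Fract a b \<longrightarrow> y = Fract (D a * b - a * D b) (b * b))"

lemma k_derivationD:
  assumes "k_derivation scale D"
  shows "D (x + y) = D x + D y" "D (scale c x) = scale c (D x)" "D (x * y) = D x * y + x * D y"
proof -
  interpret Vector_Spaces.linear scale scale D
    using assms by (simp add: k_derivation_def)
  show "D (x + y) = D x + D y" "D (scale c x) = scale c (D x)"
    by (simp_all add: add scale)
  show "D (x * y) = D x * y + x * D y"
    using assms by (simp add: k_derivation_def)
qed

lemma k_derivation_one: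
  assumes "k_derivation scale D"
  shows "D 1 = 0"
  using k_derivationD(3)[OF assms, of 1 1] by simp

lemma fract_deriv_Fract:
  assumes D: "k_derivation scale D" and "b \<noteq> 0"
  shows "fract_deriv D (Fract a b) = Fract (D a * b - a * D b) (b * b)"
  unfolding fract_deriv_def
proof (rule the_equality)
  show "\<forall>a' b'. b' \<noteq> 0 \<longrightarrow> Fract a b = Fract a' b' \<longrightarrow>
      Fract (D a * b - a * D b) (b * b) = Fract (D a' * b' - a' * D b') (b' * b')"
  proof (intro allI impI)
    fix a' b' assume b': "b' \<noteq> 0" and "Fract a b = Fract a' b'"
    hence e: "a * b' = a' * b" using \<open>b \<noteq> 0\<close> by (simp add: eq_fract)
    have "D (a * b') = D (a' * b)" by (simp add: e)
    hence d: "D a * b' + a * D b' = D a' * b + a' * D b"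
      by (simp add: k_derivationD(3)[OF D])
    have "(D a * b - a * D b) * (b' * b') = (D a' * b' - a' * D b') * (b * b)"
      using e d by algebra
    thus "Fract (D a * b - a * D b) (b * b) = Fract (D a' * b' - a' * D b') (b' * b')"
      using b' \<open>b \<noteq> 0\<close> by (simp add: eq_fract)
  qed
qed (use assms in blast)

lemma fract_deriv_to_fract:
  assumes "k_derivation scale D"
  shows "fract_deriv D (to_fract a) = to_fract (D a)"
  by (simp add: to_fract_def fract_deriv_Fract[OF assms] k_derivation_one[OF assms])

lemma comm_algebra_fract_scale:
  assumes "comm_algebra scale"
  shows "comm_algebra (fract_scale scale)"
proof -
  interpret comm_algebra scale by fact
  have m: "scale c 1 * scale d 1 = scale (c * d) 1" for c d
    by (simp add: scale_mult_left)
  show ?thesis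
    by unfold_locales
      (simp_all add: fract_scale_def algebra_simps m[symmetric] scale_left_distrib)
qed

lemma k_derivation_fract_deriv:
  assumes A: "comm_algebra scale" and D: "k_derivation scale D"
  shows "k_derivation (fract_scale scale) (fract_deriv D)"
proof -
  interpret B: comm_algebra scale by fact
  interpret F: comm_algebra "fract_scale scale" by (rule comm_algebra_fract_scale) fact
  have mult: "fract_deriv D (x * y) = fract_deriv D x * y + x * fract_deriv D y" for x y
    by (cases x, cases y)
      (simp add: fract_deriv_Fract[OF D] k_derivationD(3)[OF D] eq_fract algebra_simps)
  have add: "fract_deriv D (x + y) = fract_deriv D x + fract_deriv D y" for x y
    by (cases x, cases y)
      (simp add: fract_deriv_Fract[OF D] k_derivationD(1,3)[OF D] eq_fract algebra_simps)
  have "D (scale c 1) = 0" for c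
    by (simp add: k_derivationD(2)[OF D] k_derivation_one[OF D])
  hence "fract_deriv D (fract_scale scale c x) = fract_scale scale c (fract_deriv D x)" for c x
    by (simp add: fract_scale_def mult fract_deriv_to_fract[OF D])
  with mult add show ?thesis
    unfolding k_derivation_def by (intro conjI allI) (unfold_locales; blast)+
qed

lemma subalgebra_localization:
  assumes "comm_algebra scale" and "s \<noteq> 0"
  shows "subalgebra (fract_scale scale) (localization s)"
proof -
  interpret F: comm_algebra "fract_scale scale" by (rule comm_algebra_fract_scale) fact
  have I: "Fract a (s ^ m) \<in> localization s" for a m
    by (auto simp: localization_def)
  have mult: "x * y \<in> localization s" if "x \<in> localization s" "y \<in> localization s" for x y
    using that by (fastforce simp: localization_def simp flip: power_add)
  have T: "to_fract a \<in> localization s" for a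
    using I[of a 0] by (simp add: to_fract_def)
  have add: "x + y \<in> localization s" if "x \<in> localization s" "y \<in> localization s" for x y
    using that \<open>s \<noteq> 0\<close> by (fastforce simp: localization_def simp flip: power_add)
  show ?thesis
    unfolding subalgebra_def
    using T[of 0] T[of 1] add mult T by (auto intro!: F.subspaceI simp: fract_scale_def)
qed

lemma fract_deriv_localization:
  assumes "k_derivation scale D" and "s \<noteq> 0" and "x \<in> localization s"
  shows "fract_deriv D x \<in> localization s"
proof -
  obtain a m where "x = Fract a (s ^ m)"
    using assms(3) by (auto simp: localization_def)
  thus ?thesis
    using assms(2) fract_deriv_Fract[OF assms(1), of "s ^ m" a]
    by (auto simp: localization_def simp flip: power_add)
qed

lemma fract_deriv_unique:
  assumes D: "k_derivation scale D" and "s \<noteq> 0"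
    and ext: "\<And>a. E (to_fract a) = to_fract (D a)"
    and leibniz: "\<And>x y. x \<in> localization s \<Longrightarrow> y \<in> localization s \<Longrightarrow> E (x * y) = E x * y + x * E y"
    and x: "x \<in> localization s"
  shows "E x = fract_deriv D x"
proof -
  obtain a m where xa: "x = Fract a (s ^ m)"
    using x by (auto simp: localization_def)
  define t where "t = to_fract (s ^ m)"
  have t: "t \<in> localization s"
    unfolding t_def to_fract_def localization_def by (metis (mono_tags, lifting) mem_Collect_eq power_0)
  have t0: "t \<noteq> 0" using \<open>s \<noteq> 0\<close> by (simp add: t_def)
  have xt: "x * t = to_fract a"
    using \<open>s \<noteq> 0\<close> by (simp add: xa t_def to_fract_def eq_fract)
  have Dx: "fract_deriv D x * t + x * to_fract (D (s ^ m)) = to_fract (D a)"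
    using \<open>s \<noteq> 0\<close>
    by (simp add: xa t_def to_fract_def fract_deriv_Fract[OF D] eq_fract algebra_simps)
  have "to_fract (D a) = E x * t + x * to_fract (D (s ^ m))"
    using leibniz[OF x t] ext[of a] ext[of "s ^ m"] by (simp add: xt flip: t_def)
  with Dx have "E x * t = fract_deriv D x * t" by (metis add_right_cancel)
  with t0 show ?thesis by simp
qed

end

theory Submission
  imports Defs
begin

text \<open>Put \<open>c\<^sub>i = b\<^sub>i s\<^bsup>-\<lambda>\<^sub>i\<^esup>\<close> and \<open>C = k[c\<^sub>1, \<dots>, c\<^sub>n]\<close>.
  The finite sums \<open>\<Sum> f\<^sub>m s\<^bsup>m\<^esup>\<close> with \<open>f\<^sub>m \<in> C\<close> form an algebra that contains every
  \<open>b\<^sub>i = c\<^sub>i s\<^bsup>\<lambda>\<^sub>i\<^esup>\<close>, hence all of \<open>B\<close>. An element of the kernel has the form \<open>a / s\<^bsup>m\<^esup>\<close>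
  with \<open>D a = m a\<close>. As \<open>D\<close> vanishes on \<open>C\<close>, the term \<open>f\<^sub>i s\<^bsup>i\<^esup>\<close> in the expansion of \<open>a\<close> has
  eigenvalue \<open>i\<close>, and independence of the eigenspaces leaves only \<open>a = f\<^sub>m s\<^bsup>m\<^esup>\<close>,
  that is, \<open>a / s\<^bsup>m\<^esup> = f\<^sub>m \<in> C\<close>.\<close>

text \<open>Applying \<open>E\<close> minus multiplication by \<open>c j\<close> to the vanishing
  sum kills the term at \<open>j\<close> and multiplies every other \<open>v i\<close> by
  \<open>c i - c j\<close>, which injectivity makes nonzero. The induction hypothesis is used for
  these rescaled vectors, so it has to range over all families \<open>v\<close>.\<close>

lemma (in vector_space) eigenvectors_sum_eq_0:
  assumes "finite I" and E: "Vector_Spaces.linear scale scale E"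
    and "\<And>i. i \<in> I \<Longrightarrow> E (v i) = scale (c i) (v i)" and "inj_on c I"
    and "(\<Sum>i\<in>I. v i) = 0" and "i \<in> I"
  shows "v i = 0"
  using assms(1,3-)
proof (induction I arbitrary: v i)
  case (insert j I)
  interpret E: Vector_Spaces.linear scale scale E by (rule E)
  have s: "v j = - (\<Sum>i\<in>I. v i)"
    using insert.prems(3) insert.hyps by (simp add: eq_neg_iff_add_eq_0)
  have "0 = E (\<Sum>i\<in>insert j I. v i) - scale (c j) (\<Sum>i\<in>insert j I. v i)"
    by (simp only: insert.prems(3) E.zero scale_zero_right diff_self)
  also have "\<dots> = (\<Sum>i\<in>insert j I. scale (c i - c j) (v i))"
    by (simp only: E.sum scale_sum_right flip: sum_subtractf)
      (simp add: insert.prems(1) scale_left_diff_distrib)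
  also have "\<dots> = (\<Sum>i\<in>I. scale (c i - c j) (v i))"
    using insert.hyps by simp
  finally have z: "(\<Sum>i\<in>I. scale (c i - c j) (v i)) = 0" by simp
  have "scale (c i - c j) (v i) = 0" if "i \<in> I" for i
    by (rule insert.IH[OF _ _ z that])
      (use insert.prems(1,2) in \<open>auto simp: E.scale scale_left_commute\<close>)
  moreover have "c i \<noteq> c j" if "i \<in> I" for i
    using insert.prems(2) insert.hyps that by (auto simp: inj_on_def)
  ultimately have "v i = 0" if "i \<in> I" for i
    using that by (metis scale_eq_0_iff right_minus_eq)
  with s insert.prems(4) show ?case by auto
qed simp

context comm_algebra
begin

lemma scale_mult_right: "x * scale c y = scale c (x * y)"
  by (metis mult.commute scale_mult_left)

lemma subalgebraD:
  assumes "subalgebra scale S"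
  shows "0 \<in> S" "1 \<in> S" "x \<in> S \<Longrightarrow> y \<in> S \<Longrightarrow> x + y \<in> S" "x \<in> S \<Longrightarrow> scale c x \<in> S"
    "x \<in> S \<Longrightarrow> y \<in> S \<Longrightarrow> x * y \<in> S"
  using assms by (auto simp: subalgebra_def subspace_def)

lemma subalgebraI:
  assumes "1 \<in> S" "\<And>x y. x \<in> S \<Longrightarrow> y \<in> S \<Longrightarrow> x + y \<in> S" "\<And>c x. x \<in> S \<Longrightarrow> scale c x \<in> S"
    "\<And>x y. x \<in> S \<Longrightarrow> y \<in> S \<Longrightarrow> x * y \<in> S"
  shows "subalgebra scale S"
  \<comment> \<open>The zero vector lies in \<open>S\<close> as the multiple of \<open>1\<close> by
    the scalar \<open>0\<close>.\<close>
  using assms assms(3)[of 1 0] by (auto simp: subalgebra_def subspace_def)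

lemma subalgebra_generated_subalgebra: "subalgebra scale (generated_subalgebra scale U)"
  by (rule subalgebraI) (auto simp: generated_subalgebra_def intro: subalgebraD)

lemma generated_subalgebra_superset: "U \<subseteq> generated_subalgebra scale U"
  by (auto simp: generated_subalgebra_def)

lemma generated_subalgebra_minimal:
  "subalgebra scale S \<Longrightarrow> U \<subseteq> S \<Longrightarrow> generated_subalgebra scale U \<subseteq> S"
  by (auto simp: generated_subalgebra_def)

lemma subalgebra_derivation_kernel:
  assumes "k_derivation scale E"
  shows "subalgebra scale {x. E x = 0}"
  by (rule subalgebraI)
    (auto simp: k_derivationD[OF assms] k_derivation_one[OF assms])

lemma eigenspace_mult:
  assumes "k_derivation scale E" and "E x = scale c x" and "E y = scale d y"
  shows "E (x * y) = scale (c + d) (x * y)"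
  by (simp add: k_derivationD(3)[OF assms(1)] assms(2,3) scale_mult_left scale_mult_right
      scale_left_distrib)

end

text \<open>By the Leibniz rule and division by \<open>t\<close>, the claims for \<open>m\<close>
  and \<open>m + 1\<close> are equivalent. This equivalence drives the induction in both directions
  from \<open>t powi 0 = 1\<close>, which \<open>E\<close> sends to \<open>0\<close>.\<close>

lemma eigenspace_power_int:
  fixes scale :: "'k::field \<Rightarrow> 'b::field \<Rightarrow> 'b"
  assumes "comm_algebra scale" and E: "k_derivation scale E" and "t \<noteq> 0" and t: "E t = t"
  shows "E (t powi m) = scale (of_int m) (t powi m)"
proof -
  interpret comm_algebra scale by fact
  have step: "E (t powi (m + 1)) = E (t powi m) * t + t powi m * t" for m
    using \<open>t \<noteq> 0\<close> by (simp add: power_int_add k_derivationD(3)[OF E] t)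
  have shift: "E (t powi (m + 1)) = scale (of_int (m + 1)) (t powi (m + 1)) \<longleftrightarrow>
      E (t powi m) = scale (of_int m) (t powi m)" for m
  proof -
    have "scale (of_int (m + 1)) (t powi (m + 1)) = scale (of_int m) (t powi m) * t + t powi m * t"
      using \<open>t \<noteq> 0\<close> by (simp add: power_int_add scale_left_distrib scale_mult_left)
    thus ?thesis using \<open>t \<noteq> 0\<close> by (simp add: step)
  qed
  show ?thesis
  proof (induction m rule: int_induct[where k = 0])
    case base
    show ?case by (simp add: k_derivation_one[OF E])
  next
    case (step1 i)
    thus ?case using shift[of i] by blast
  next
    case (step2 i)
    thus ?case using shift[of "i - 1"] by simp
  qed
qed

text \<open>For a subalgebra \<open>C\<close> this is the ring of Laurent polynomial expressions in
  \<open>t\<close> over \<open>C\<close>. The coefficients form a total function vanishing off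
  \<open>I\<close>, so that \<open>I\<close> can be enlarged freely.\<close>

definition laurent_sums :: "'b::field set \<Rightarrow> 'b \<Rightarrow> 'b set" where
  "laurent_sums C t =
     {\<Sum>i\<in>I. f i * t powi i | I f. finite I \<and> (\<forall>i. f i \<in> C) \<and> (\<forall>i. i \<notin> I \<longrightarrow> f i = 0)}"

lemma subalgebra_laurent_sums:
  fixes scale :: "'k::field \<Rightarrow> 'b::field \<Rightarrow> 'b"
  assumes "comm_algebra scale" and C: "subalgebra scale C" and "t \<noteq> 0"
  shows "subalgebra scale (laurent_sums C t)"
    and "x \<in> C \<Longrightarrow> x * t powi m \<in> laurent_sums C t"
proof -
  interpret comm_algebra scale by fact
  note CD = subalgebraD[OF C]
  show mono: "x * t powi m \<in> laurent_sums C t" if "x \<in> C" for x m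
    unfolding laurent_sums_def using that CD(1)
    by (auto intro!: exI[of _ "{m}"] exI[of _ "\<lambda>i. if i = m then x else 0"] split: if_splits)
  have add: "x + y \<in> laurent_sums C t" if xy: "x \<in> laurent_sums C t" "y \<in> laurent_sums C t" for x y
  proof -
    obtain I f where I: "finite I" "\<forall>i. f i \<in> C" "\<forall>i. i \<notin> I \<longrightarrow> f i = 0"
      and x: "x = (\<Sum>i\<in>I. f i * t powi i)"
      using xy(1) by (auto simp: laurent_sums_def)
    obtain J g where J: "finite J" "\<forall>i. g i \<in> C" "\<forall>i. i \<notin> J \<longrightarrow> g i = 0"
      and y: "y = (\<Sum>i\<in>J. g i * t powi i)"
      using xy(2) by (auto simp: laurent_sums_def)
    \<comment> \<open>Both expansions are padded with zero coefficients to a common index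
      set.\<close>
    have "x = (\<Sum>i\<in>I \<union> J. f i * t powi i)" "y = (\<Sum>i\<in>I \<union> J. g i * t powi i)"
      unfolding x y using I J by (auto intro!: sum.mono_neutral_left)
    hence "x + y = (\<Sum>i\<in>I \<union> J. (f i + g i) * t powi i)"
      by (simp add: distrib_right sum.distrib)
    thus ?thesis
      unfolding laurent_sums_def using I J CD(3)
      by (auto intro!: exI[of _ "I \<union> J"] exI[of _ "\<lambda>i. f i + g i"])
  qed
  \<comment> \<open>This reduces closure under scaling and products to single monomials, so no
    convolution of coefficients is computed. A sum over an infinite set is \<open>0\<close> by
    convention, hence finiteness need not be carried along.\<close>
  have sum: "(\<Sum>i\<in>I. h i) \<in> laurent_sums C t" if "\<And>i. i \<in> I \<Longrightarrow> h i \<in> laurent_sums C t"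
    for I :: "int set" and h
    using that mono[OF CD(1)] by (induction I rule: infinite_finite_induct) (auto intro: add)
  show "subalgebra scale (laurent_sums C t)"
  proof (rule subalgebraI)
    show "1 \<in> laurent_sums C t" using mono[OF CD(2), of 0] by simp
  next
    fix c x assume "x \<in> laurent_sums C t"
    then obtain I f where f: "\<forall>i. f i \<in> C" and x: "x = (\<Sum>i\<in>I. f i * t powi i)"
      by (auto simp: laurent_sums_def)
    have "scale c x = (\<Sum>i\<in>I. scale c (f i) * t powi i)"
      by (simp add: x scale_sum_right scale_mult_left)
    thus "scale c x \<in> laurent_sums C t" using f by (auto intro!: sum mono CD(4))
  next
    fix x y assume xy: "x \<in> laurent_sums C t" "y \<in> laurent_sums C t"
    obtain I f where f: "\<forall>i. f i \<in> C" and x: "x = (\<Sum>i\<in>I. f i * t powi i)"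
      using xy(1) by (auto simp: laurent_sums_def)
    obtain J g where g: "\<forall>i. g i \<in> C" and y: "y = (\<Sum>i\<in>J. g i * t powi i)"
      using xy(2) by (auto simp: laurent_sums_def)
    have "x * y = (\<Sum>i\<in>I. \<Sum>j\<in>J. (f i * g j) * t powi (i + j))"
      unfolding x y sum_product using \<open>t \<noteq> 0\<close>
      by (intro sum.cong refl) (simp add: power_int_add)
    thus "x * y \<in> laurent_sums C t" using f g by (auto intro!: sum mono CD(5))
  qed (rule add)
qed

lemma laurent_sums_eigenvector:
  fixes scale :: "'k::field_char_0 \<Rightarrow> 'b::field \<Rightarrow> 'b"
  assumes "comm_algebra scale" and E: "k_derivation scale E" and "t \<noteq> 0" and "E t = t"
    and C: "0 \<in> C" "C \<subseteq> {x. E x = 0}"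
    and x: "x \<in> laurent_sums C t" "E x = scale (of_int m) x"
  obtains y where "y \<in> C" "x = y * t powi m"
proof -
  interpret comm_algebra scale by fact
  have lin: "Vector_Spaces.linear scale scale E" using E by (simp add: k_derivation_def)
  obtain I f where "finite I" and f: "\<forall>i. f i \<in> C" and f0: "\<forall>i. i \<notin> I \<longrightarrow> f i = 0"
    and xf: "x = (\<Sum>i\<in>I. f i * t powi i)"
    using x(1) by (auto simp: laurent_sums_def)
  \<comment> \<open>Subtracting \<open>x\<close> at the index \<open>m\<close> turns the expansion
    of \<open>x\<close> into a vanishing sum of eigenvectors with eigenvalues
    \<open>of_int i\<close>, pairwise distinct in characteristic zero. Then \<open>v m = 0\<close>
    reads \<open>x = f m * t powi m\<close>.\<close>
  define v where "v i = f i * t powi i - (if i = m then x else 0)" for i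
  interpret E: Vector_Spaces.linear scale scale E by (rule lin)
  have "E (f i * t powi i) = scale (of_int i) (f i * t powi i)" for i
    using eigenspace_mult[OF E, of "f i" 0 "t powi i" "of_int i"] f C(2)
      eigenspace_power_int[OF assms(1-4)] by auto
  hence ev: "E (v i) = scale (of_int i) (v i)" for i
    using x(2) by (simp add: v_def E.diff scale_right_diff_distrib)
  \<comment> \<open>The index \<open>m\<close> may lie outside \<open>I\<close>; in that case
    \<open>f m = 0\<close>.\<close>
  have "(\<Sum>i\<in>insert m I. f i * t powi i) = x"
    unfolding xf using \<open>finite I\<close> f0 by (intro sum.mono_neutral_right) auto
  hence "(\<Sum>i\<in>insert m I. v i) = 0"
    using \<open>finite I\<close> by (simp add: v_def sum_subtractf)
  hence "v m = 0"
    by (intro eigenvectors_sum_eq_0[OF _ lin ev]) (use \<open>finite I\<close> in \<open>auto simp: inj_on_def\<close>)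
  thus thesis using that[of "f m"] f by (simp add: v_def)
qed

lemma fract_scale_to_fract:
  assumes "comm_algebra scale"
  shows "to_fract (scale c a) = fract_scale scale c (to_fract a)"
proof -
  interpret comm_algebra scale by fact
  have "scale c a = scale c 1 * a" by (simp add: scale_mult_left)
  thus ?thesis unfolding fract_scale_def by (metis to_fract_mult)
qed

lemma to_fract_power: "to_fract (a ^ m) = to_fract a ^ m"
  by (induction m) simp_all

text \<open>Clearing the denominator makes membership an equation in the field of fractions.\<close>

lemma localization_iff:
  assumes "s \<noteq> 0"
  shows "x \<in> localization s \<longleftrightarrow> (\<exists>a m. x * to_fract s ^ m = to_fract a)"
proof -
  have "x = Fract a (s ^ m) \<longleftrightarrow> x * to_fract s ^ m = to_fract a" for a m
    using assms by (simp add: Fract_conv_to_fract to_fract_power divide_simps)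
  thus ?thesis by (auto simp: localization_def)
qed

theorem proposition4p3:
  fixes scale :: "'k::{alg_closed_field, field_char_0} \<Rightarrow> 'b::idom \<Rightarrow> 'b"
    and D :: "'b \<Rightarrow> 'b"
    and s :: 'b
    and n :: nat
    and b :: "nat \<Rightarrow> 'b"
    and lam :: "nat \<Rightarrow> int"
  assumes "comm_algebra scale"
    and "finitely_generated_algebra scale"
    and "k_derivation scale D"
    and "semisimple scale D"
    and "eigenvalues scale D \<subseteq> \<int>"
    and "s \<noteq> 0" and "D s = s"
    and "generated_subalgebra scale (b ` {1..n}) = UNIV"
    and "\<And>i. i \<in> {1..n} \<Longrightarrow> D (b i) = scale (of_int (lam i)) (b i)"
  shows "{x \<in> localization s. fract_deriv D x = 0} =
    generated_subalgebra (fract_scale scale)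
      ((\<lambda>i. to_fract (b i) * to_fract s powi (- lam i)) ` {1..n})"
proof -
  interpret B: comm_algebra scale by fact
  let ?sc = "fract_scale scale" and ?E = "fract_deriv D"
  have A: "comm_algebra ?sc" by (rule comm_algebra_fract_scale) fact
  interpret F: comm_algebra ?sc by (rule A)
  have E: "k_derivation ?sc ?E" by (rule k_derivation_fract_deriv) fact+
  note D = \<open>k_derivation scale D\<close>
  define t where "t = to_fract s"
  have t: "t \<noteq> 0" "?E t = t"
    using \<open>s \<noteq> 0\<close> \<open>D s = s\<close> by (simp_all add: t_def fract_deriv_to_fract[OF D])
  note powE = eigenspace_power_int[OF A E t]
  define u where "u i = to_fract (b i) * t powi (- lam i)" for i
  define C where "C = generated_subalgebra ?sc (u ` {1..n})"
  have C: "subalgebra ?sc C"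
    unfolding C_def by (rule F.subalgebra_generated_subalgebra)
  have Eb: "?E (to_fract (b i)) = ?sc (of_int (lam i)) (to_fract (b i))" if "i \<in> {1..n}" for i
    using assms(9)[OF that] assms(1) by (simp add: fract_deriv_to_fract[OF D] fract_scale_to_fract)
  \<comment> \<open>The eigenvalues \<open>lam i\<close> and \<open>- lam i\<close> of the two
    factors add up to \<open>0\<close>.\<close>
  have Eu: "?E (u i) = 0" if "i \<in> {1..n}" for i
    using F.eigenspace_mult[OF E Eb[OF that] powE[of "- lam i"]] by (simp add: u_def)
  have "C \<subseteq> {x. ?E x = 0}"
    unfolding C_def using Eu
    by (intro F.generated_subalgebra_minimal F.subalgebra_derivation_kernel[OF E]) auto
  have "u i \<in> localization s" for i
  \<comment> \<open>For \<open>lam i \<ge> 0\<close> the power \<open>s ^ nat (lam i)\<close> clears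
    the denominator; otherwise \<open>u i\<close> already comes from the ring itself.\<close>
  proof (cases "lam i \<ge> 0")
    case True
    hence "u i * t ^ nat (lam i) = to_fract (b i)"
      using t(1) by (simp add: u_def power_int_def power_inverse)
    thus ?thesis using \<open>s \<noteq> 0\<close> by (auto simp: localization_iff t_def)
  next
    case False
    hence "u i * t ^ 0 = to_fract (b i * s ^ nat (- lam i))"
      by (simp add: u_def power_int_def to_fract_power t_def)
    thus ?thesis using \<open>s \<noteq> 0\<close> unfolding localization_iff[OF \<open>s \<noteq> 0\<close>] t_def by blast
  qed
  hence "C \<subseteq> localization s"
    unfolding C_def
    by (intro F.generated_subalgebra_minimal subalgebra_localization[OF assms(1)] \<open>s \<noteq> 0\<close>) auto
  note L = subalgebra_laurent_sums[OF A C t(1)]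
  \<comment> \<open>The preimage of the Laurent sums under \<open>to_fract\<close> is a subalgebra
    containing all generators \<open>b i\<close>, hence everything.\<close>
  have "generated_subalgebra scale (b ` {1..n}) \<subseteq> {a. to_fract a \<in> laurent_sums C t}"
  proof (rule B.generated_subalgebra_minimal)
    show "subalgebra scale {a. to_fract a \<in> laurent_sums C t}"
      using F.subalgebraD[OF L(1)]
      by (intro B.subalgebraI) (auto simp: fract_scale_to_fract[OF assms(1)])
    have "to_fract (b i) \<in> laurent_sums C t" if "i \<in> {1..n}" for i
    proof -
      have "u i \<in> C"
        unfolding C_def using that by (intro subsetD[OF F.generated_subalgebra_superset] imageI)
      hence "u i * t powi lam i \<in> laurent_sums C t" by (rule L(2))
      thus ?thesis using t(1) by (simp add: u_def power_int_minus mult.assoc)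
    qed
    thus "b ` {1..n} \<subseteq> {a. to_fract a \<in> laurent_sums C t}" by auto
  qed
  hence T: "to_fract a \<in> laurent_sums C t" for a
    using assms(8) by auto
  have "x \<in> C" if x: "x \<in> localization s" "?E x = 0" for x
  proof -
    obtain a m where a: "x * t ^ m = to_fract a"
      using x(1) localization_iff[OF \<open>s \<noteq> 0\<close>] by (auto simp: t_def)
    \<comment> \<open>The factor \<open>x\<close> has eigenvalue \<open>0\<close> and
      \<open>t ^ m\<close> has eigenvalue \<open>m\<close>.\<close>
    have "?E (to_fract a) = ?sc (of_int (int m)) (to_fract a)"
      using F.eigenspace_mult[OF E _ powE[of "int m"], of x 0] x(2) by (simp flip: a)
    from laurent_sums_eigenvector[OF A E t F.subalgebraD(1)[OF C] \<open>C \<subseteq> {x. ?E x = 0}\<close> T this]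
    obtain y where "y \<in> C" "to_fract a = y * t powi int m" .
    with a t(1) show ?thesis by simp
  qed
  with \<open>C \<subseteq> {x. ?E x = 0}\<close> \<open>C \<subseteq> localization s\<close>
  have "{x \<in> localization s. ?E x = 0} = C" by auto
  thus ?thesis by (simp add: C_def u_def t_def)
qed

end
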